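(* Let $X$ be a Banach space with dual $X^*$, and let $I=\Phi+\Psi:X\to(-\infty,\infty]$ with $\Phi:X\to\mathbb{R}$ locally Lipschitz and $\Psi:X\to(-\infty,\infty]$ convex, lower semicontinuous and proper. Let $c\in\mathbb{R}$. A sequence $(u_n)$ is a $(\mathrm{PS})_c$ sequence for $I$ if and only if $I(u_n)\to c$ and there exists a sequence $(w_n)$ in $X^*$ with $w_n\to0$ in $X^*$ such that $$w_n\in\partial\Phi(u_n)+\partial\Psi(u_n),\qquad n\in\mathbb{N}.$$
   Context: For $\Phi$ locally Lipschitz, $\Phi^\circ(u;v)=\limsup_{w\to u,\,t\to0^+}\frac{\Phi(w+tv)-\Phi(w)}{t}$ and $\partial\Phi(u)=\{\phi\in X^*:\Phi^\circ(u;v)\ge\langle\phi,v\rangle\ \forall v\in X\}$ (generalized gradient). For $\Psi$ convex, $\partial\Psi(u)=\{\phi\in X^*:\Psi(v)-\Psi(u)\ge\langle\phi,v-u\rangle\ \forall v\in X\}$ (subdifferential), for $u$ in the effective domain $D(I)=D(\Psi)=\{u:\Psi(u)<\infty\}$ (and empty otherwise). A sequence $(u_n)$ (in $D(I)$) is a $(\mathrm{PS})_c$ sequence for $I$ if $I(u_n)\to c$ and there are $\varepsilon_n\to0^+$ with $\Phi^\circ(u_n;v-u_n)+\Psi(v)-\Psi(u_n)\ge-\varepsilon_n\|v-u_n\|$ for all $v\in X$; this is known to be equivalent to $I(u_n)\to c$ and $\Phi^\circ(u_n;v-u_n)+\Psi(v)-\Psi(u_n)\ge\langle w_n,v-u_n\rangle$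 for all $v\in X$, with some $w_n\to0$ in $X^*$. *)

theory Defs
  imports "HOL-Analysis.Analysis"
begin

text \<open>
  The dual of a real normed space \<open>'a\<close> is the type \<open>'a \<Rightarrow>\<^sub>L real\<close> of bounded linear functionals
  with the operator norm. Functions with values in the half-open extended real line are
  functions into \<^typ>\<open>ereal\<close>; that they omit \<open>-\<infinity>\<close> is part of \<open>proper_fun\<close>.
\<close>

definition locally_lipschitz :: "('a::metric_space \<Rightarrow> 'b::metric_space) \<Rightarrow> bool"
  where "locally_lipschitz f \<longleftrightarrow> (\<forall>x. \<exists>r>0. \<exists>L. L-lipschitz_on (ball x r) f)"

definition proper_fun :: "('a \<Rightarrow> ereal) \<Rightarrow> bool"
  where "proper_fun f \<longleftrightarrow> (\<forall>x. f x > -\<infinity>) \<and> (\<exists>x. f x < \<infinity>)"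

text \<open>The library's \<open>convex_on\<close> is restricted to real-valued functions. In \<^typ>\<open>ereal\<close> we have
  \<open>0 * \<infinity> = 0\<close>, so the end points \<open>s = 0\<close> and \<open>t = 0\<close> add no condition.\<close>

definition convex_ereal :: "('a::real_vector \<Rightarrow> ereal) \<Rightarrow> bool"
  where "convex_ereal f \<longleftrightarrow>
    (\<forall>x y. \<forall>s\<ge>0. \<forall>t\<ge>0. s + t = 1 \<longrightarrow>
       f (s *\<^sub>R x + t *\<^sub>R y) \<le> ereal s * f x + ereal t * f y)"

definition lower_semicontinuous :: "('a::topological_space \<Rightarrow> ereal) \<Rightarrow> bool"
  where "lower_semicontinuous f \<longleftrightarrow> (\<forall>x. f x \<le> Liminf (at x) f)"

text \<open>The base point \<open>w\<close> may equal \<open>u\<close>, hence \<^term>\<open>nhds u\<close> rather than \<^term>\<open>at u\<close>. The value is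
  an extended real because the upper limit is taken in a complete lattice; it is finite when
  \<open>\<Phi>\<close> is locally Lipschitz.\<close>

definition clarke_deriv :: "('a::real_normed_vector \<Rightarrow> real) \<Rightarrow> 'a \<Rightarrow> 'a \<Rightarrow> ereal"
  where "clarke_deriv \<Phi> u v =
    Limsup (nhds u \<times>\<^sub>F at_right 0) (\<lambda>(w, t). ereal ((\<Phi> (w + t *\<^sub>R v) - \<Phi> w) / t))"

definition generalized_gradient ::
    "('a::real_normed_vector \<Rightarrow> real) \<Rightarrow> 'a \<Rightarrow> ('a \<Rightarrow>\<^sub>L real) set"
  where "generalized_gradient \<Phi> u =
    {\<phi>. \<forall>v. clarke_deriv \<Phi> u v \<ge> ereal (blinfun_apply \<phi> v)}"

definition effective_domain :: "('a \<Rightarrow> ereal) \<Rightarrow> 'a set"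
  where "effective_domain f = {u. f u < \<infinity>}"

definition subdifferential ::
    "('a::real_normed_vector \<Rightarrow> ereal) \<Rightarrow> 'a \<Rightarrow> ('a \<Rightarrow>\<^sub>L real) set"
  where "subdifferential \<Psi> u =
    {\<phi>. u \<in> effective_domain \<Psi> \<and>
        (\<forall>v. \<Psi> v - \<Psi> u \<ge> ereal (blinfun_apply \<phi> (v - u)))}"

definition functional_sum :: "('a \<Rightarrow> real) \<Rightarrow> ('a \<Rightarrow> ereal) \<Rightarrow> 'a \<Rightarrow> ereal"
  where "functional_sum \<Phi> \<Psi> u = ereal (\<Phi> u) + \<Psi> u"

text \<open>The notion depends on the decomposition of the functional into \<open>\<Phi>\<close> and \<open>\<Psi>\<close>. As \<open>u n\<close> lies
  in the effective domain, subtracting \<open>\<Psi> (u n)\<close> below never involves \<open>\<infinity> - \<infinity>\<close> for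
  proper \<open>\<Psi>\<close>.\<close>

definition PS_sequence ::
    "('a::real_normed_vector \<Rightarrow> real) \<Rightarrow> ('a \<Rightarrow> ereal) \<Rightarrow> real \<Rightarrow> (nat \<Rightarrow> 'a) \<Rightarrow> bool"
  where "PS_sequence \<Phi> \<Psi> c u \<longleftrightarrow>
    (\<forall>n. u n \<in> effective_domain (functional_sum \<Phi> \<Psi>)) \<and>
    (\<lambda>n. functional_sum \<Phi> \<Psi> (u n)) \<longlonglongrightarrow> ereal c \<and>
    (\<exists>\<epsilon> :: nat \<Rightarrow> real. (\<forall>n. \<epsilon> n > 0) \<and> \<epsilon> \<longlonglongrightarrow> 0 \<and>
       (\<forall>n v. clarke_deriv \<Phi> (u n) (v - u n) + \<Psi> v - \<Psi> (u n)
                \<ge> ereal (- \<epsilon> n * norm (v - u n))))"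

end

theory Submission
  imports Defs
begin

text \<open>
  The forward direction is a Hahn--Banach argument. Fix \<open>n\<close>, write \<open>p\<close> for the sublinear function
  \<open>v \<mapsto> \<Phi>\<degree>(u\<^sub>n; v)\<close> and \<open>f h = \<Psi> (u\<^sub>n + h) - \<Psi> u\<^sub>n\<close>. The Palais--Smale inequality says
  \<open>- f \<le> p + \<epsilon>\<^sub>n \<parallel>\<cdot>\<parallel>\<close> with \<open>f\<close> convex, so a linear \<open>m\<close> lies in between; then
  \<open>m - \<epsilon>\<^sub>n \<parallel>\<cdot>\<parallel> \<le> p\<close>, so a linear \<open>\<phi>\<close> lies in between again. Now \<open>\<phi> \<in> \<partial>\<Phi>(u\<^sub>n)\<close>, \<open>- m \<in> \<partial>\<Psi>(u\<^sub>n)\<close> and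
  \<open>\<parallel>\<phi> - m\<parallel> \<le> \<epsilon>\<^sub>n\<close>. The sandwich theorem itself holds because a minimal sublinear function is linear.
\<close>

subsection \<open>Sublinear functions and the sandwich theorem\<close>

definition sublinear :: "('a::real_vector \<Rightarrow> real) \<Rightarrow> bool"
  where "sublinear p \<longleftrightarrow>
    (\<forall>x y. p (x + y) \<le> p x + p y) \<and> (\<forall>s\<ge>0. \<forall>x. p (s *\<^sub>R x) = s * p x)"

lemma sublinear_add: "sublinear p \<Longrightarrow> p (x + y) \<le> p x + p y"
  and sublinear_scale: "sublinear p \<Longrightarrow> 0 \<le> s \<Longrightarrow> p (s *\<^sub>R x) = s * p x"
  by (auto simp: sublinear_def)

text \<open>One inequality suffices: using it for \<open>inverse s\<close> and the point
  \<open>s *\<^sub>R x\<close> gives the reverse one. The value at 0 covers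
  \<open>s = 0\<close>.\<close>

lemma sublinearI:
  assumes "\<And>x y. p (x + y) \<le> p x + p y"
    and ge: "\<And>s x. 0 < s \<Longrightarrow> s * p x \<le> p (s *\<^sub>R x)" and "p 0 = 0"
  shows "sublinear p"
proof -
  have "p (s *\<^sub>R x) = s * p x" if "s \<ge> 0" for s x
  proof (cases "s = 0")
    case False
    with that have "s > 0" by simp
    moreover from this have "inverse s * p (s *\<^sub>R x) \<le> p x"
      using ge[of "inverse s" "s *\<^sub>R x"] by simp
    ultimately show ?thesis using ge[of s x] by (simp add: field_simps)
  qed (simp add: \<open>p 0 = 0\<close>)
  with assms(1) show ?thesis by (simp add: sublinear_def)
qed

lemma sublinear_zero: "sublinear p \<Longrightarrow> p 0 = 0"
  using sublinear_scale[of p 0 0] by simp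

lemma sublinear_minus_ge: "sublinear p \<Longrightarrow> - p (- x) \<le> p x"
  using sublinear_add[of p x "- x"] sublinear_zero[of p] by simp

lemma sublinear_odd_imp_linear:
  assumes p: "sublinear p" and odd: "\<And>x. p (- x) \<le> - p x"
  shows "linear p"
proof (rule linearI)
  have neg: "p (- x) = - p x" for x
    using odd[of x] sublinear_minus_ge[OF p, of x] by simp
  show "p (x + y) = p x + p y" for x y
    using sublinear_add[OF p, of x y] sublinear_add[OF p, of "- x" "- y"] neg[of "x + y"]
    by (simp add: neg)
  show "p (s *\<^sub>R x) = s *\<^sub>R p x" for s x
  proof (cases "s \<ge> 0")
    case True
    then show ?thesis by (simp add: sublinear_scale[OF p])
  next
    case False
    then have "p ((- s) *\<^sub>R x) = (- s) * p x" by (intro sublinear_scale[OF p]) simp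
    then show ?thesis by (simp add: neg)
  qed
qed

text \<open>The function \<open>q\<close> is lowered by an infimal convolution over the cone
  \<open>K\<close> generated by \<open>E\<close>. The cone makes the result positively homogeneous,
  and its closure under addition, due to the convexity of \<open>E\<close>, makes it subadditive.
  The hypothesis relating \<open>q\<close> and \<open>E\<close> keeps the infimum finite.\<close>

lemma sublinear_below_convex:
  fixes q :: "'a::real_vector \<Rightarrow> real" and E :: "('a \<times> real) set"
  assumes q: "sublinear q" and E: "convex E" "E \<noteq> {}"
    and ge: "\<And>d b. (d, b) \<in> E \<Longrightarrow> 0 \<le> q d + b"
  obtains r where "sublinear r" "\<And>x. r x \<le> q x" "\<And>d b. (d, b) \<in> E \<Longrightarrow> r (- d) \<le> b"
proof -
  define K where "K = cone hull E"
  have Kconv: "convex K" and Kcone: "cone K"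
    unfolding K_def using E by (auto intro: convex_cone_hull cone_cone_hull)
  then have Kadd: "x + y \<in> K" if "x \<in> K" "y \<in> K" for x y
    using that convex_cone[of K] by auto
  have EK: "E \<subseteq> K" by (simp add: K_def hull_subset)
  then have K0: "0 \<in> K" using E(2) Kcone cone_contains_0 by fastforce
  have Kge: "0 \<le> q k + b" if "(k, b) \<in> K" for k b
  proof -
    have "\<exists>s z. (k, b) = s *\<^sub>R z \<and> 0 \<le> s \<and> z \<in> E"
      using that unfolding K_def cone_hull_expl by blast
    then obtain s d e where "0 \<le> s" "(d, e) \<in> E" "k = s *\<^sub>R d" "b = s * e" by auto
    moreover from this have "0 \<le> s * (q d + e)" using ge by simp
    ultimately show ?thesis using q by (simp add: sublinear_scale algebra_simps)
  qed
  define g where "g x z = q (x + fst z) + snd z" for x and z :: "'a \<times> real"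
  \<comment> \<open>the largest sublinear function satisfying both bounds\<close>
  define r where "r x = (INF z\<in>K. g x z)" for x
  \<comment> \<open>For \<open>z = (k, b)\<close>, subadditivity gives
    \<open>q k \<le> q (x + k) + q (- x)\<close>, and \<open>Kge\<close> gives
    \<open>- b \<le> q k\<close>. The resulting bound does not depend on \<open>z\<close>.\<close>
  have lower: "- q (- x) \<le> g x z" if "z \<in> K" for x z
    using Kge[of "fst z" "snd z"] sublinear_add[OF q, of "x + fst z" "- x"] that
    by (simp add: g_def)
  have bdd: "bdd_below (g x ` K)" for x
    using lower by (auto intro!: bdd_belowI[of _ "- q (- x)"])
  have r_le: "r x \<le> g x z" if "z \<in> K" for x z
    unfolding r_def using bdd that by (rule cINF_lower)
  have le_r: "a \<le> r x" if "\<And>z. z \<in> K \<Longrightarrow> a \<le> g x z" for a x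
    unfolding r_def using K0 that by (intro cINF_greatest) auto
  have add: "r (x + y) \<le> r x + r y" for x y
  proof -
    have "r (x + y) - g x z \<le> r y" if z: "z \<in> K" for z
    proof (rule le_r)
      fix z' assume "z' \<in> K"
      then have "r (x + y) \<le> g (x + y) (z + z')" using r_le Kadd z by blast
      also have "\<dots> \<le> g x z + g y z'"
        using sublinear_add[OF q, of "x + fst z" "y + fst z'"]
        by (simp add: g_def algebra_simps)
      finally show "r (x + y) - g x z \<le> g y z'" by simp
    qed
    then have "r (x + y) - r y \<le> r x" by (intro le_r) (simp add: algebra_simps)
    then show ?thesis by simp
  qed
  have scale_ge: "s * r x \<le> r (s *\<^sub>R x)" if "s > 0" for s x
  proof (rule le_r)
    fix z assume "z \<in> K"
    then have "inverse s *\<^sub>R z \<in> K" using Kcone that by (simp add: mem_cone)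
    then have "s * r x \<le> s * g x (inverse s *\<^sub>R z)" using r_le that by simp
    also have "\<dots> = q (s *\<^sub>R (x + inverse s *\<^sub>R fst z)) + snd z"
      using that by (simp add: g_def sublinear_scale[OF q] distrib_left)
    also have "\<dots> = g (s *\<^sub>R x) z" using that by (simp add: g_def scaleR_add_right)
    finally show "s * r x \<le> g (s *\<^sub>R x) z" .
  qed
  have r0: "r 0 = 0"
  proof (rule antisym)
    show "r 0 \<le> 0" using r_le[OF K0, of 0] by (simp add: g_def sublinear_zero[OF q])
    show "0 \<le> r 0" using lower[of _ 0] by (intro le_r) (simp add: sublinear_zero[OF q])
  qed
  show ?thesis
  proof
    show "sublinear r" by (rule sublinearI) (fact add scale_ge r0)+
    \<comment> \<open>The two bounds come from testing the infimum at the apex of \<open>K\<close>,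
      and at \<open>(d, b)\<close> itself, where \<open>q\<close> is evaluated at
      \<open>- d + d = 0\<close>.\<close>
    show "r x \<le> q x" for x using r_le[OF K0, of x] by (simp add: g_def)
    show "r (- d) \<le> b" if "(d, b) \<in> E" for d b
      using r_le[of "(d, b)" "- d"] that EK by (auto simp: g_def sublinear_zero[OF q])
  qed
qed

section \<open>Linear minorants by Zorn's lemma\<close>

text \<open>The pointwise infimum works. An infimum of sublinear functions need not be subadditive,
  but in a chain the smaller of \<open>p\<close> and \<open>p'\<close> serves at both points. The
  common majorant \<open>q\<close> keeps the infimum finite.\<close>

lemma sublinear_Inf_chain:
  fixes C :: "('a::real_vector \<Rightarrow> real) set"
  assumes ne: "C \<noteq> {}" and sub: "\<And>p. p \<in> C \<Longrightarrow> sublinear p"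
    and le: "\<And>p x. p \<in> C \<Longrightarrow> p x \<le> q x"
    and chain: "\<And>p p'. p \<in> C \<Longrightarrow> p' \<in> C \<Longrightarrow> p \<le> p' \<or> p' \<le> p"
  obtains r where "sublinear r" "\<And>p. p \<in> C \<Longrightarrow> r \<le> p"
proof -
  define r where "r x = (INF p\<in>C. p x)" for x
  have "bdd_below ((\<lambda>p. p x) ` C)" for x
  proof (rule bdd_belowI2)
    fix p assume p: "p \<in> C"
    show "- q (- x) \<le> p x"
      using sublinear_minus_ge[OF sub[OF p], of x] le[OF p, of "- x"] by linarith
  qed
  then have r_le: "r x \<le> p x" if "p \<in> C" for p x
    unfolding r_def using that by (rule cINF_lower)
  have le_r: "a \<le> r x" if "\<And>p. p \<in> C \<Longrightarrow> a \<le> p x" for a x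
    unfolding r_def using ne that by (intro cINF_greatest) auto
  have add: "r (x + y) \<le> r x + r y" for x y
  proof -
    have "r (x + y) - p x \<le> r y" if p: "p \<in> C" for p
    proof (rule le_r)
      fix p' assume p': "p' \<in> C"
      obtain m where m: "m \<in> C" "m \<le> p" "m \<le> p'" using chain[OF p p'] p p' by auto
      have "r (x + y) \<le> m (x + y)" using r_le m(1) by blast
      also have "\<dots> \<le> m x + m y" using sublinear_add[OF sub[OF m(1)]] .
      also have "\<dots> \<le> p x + p' y" using m(2,3) by (intro add_mono) (auto simp: le_fun_def)
      finally show "r (x + y) - p x \<le> p' y" by simp
    qed
    then have "r (x + y) - r y \<le> r x" by (intro le_r) (simp add: algebra_simps)
    then show ?thesis by simp
  qed
  have scale_ge: "s * r x \<le> r (s *\<^sub>R x)" if "s > 0" for s x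
    using that r_le by (intro le_r) (simp add: sublinear_scale[OF sub] mult_left_mono)
  have r0: "r 0 = 0"
    unfolding r_def using ne by (simp add: sublinear_zero[OF sub])
  have "sublinear r" by (rule sublinearI) (fact add scale_ge r0)+
  then show ?thesis using that r_le by (auto simp: le_fun_def)
qed

theorem sublinear_dominates_linear:
  fixes q :: "'a::real_vector \<Rightarrow> real"
  assumes q: "sublinear q"
  obtains m where "linear m" "\<And>x. m x \<le> q x"
proof -
  define A where "A = {p. sublinear p \<and> p \<le> q}"
  \<comment> \<open>The order is reversed, so that the maximal element from Zorn's lemma is a
    minimal sublinear function below \<open>q\<close>.\<close>
  define P where "P = (\<lambda>f g :: 'a \<Rightarrow> real. g \<le> f)"
  have "\<exists>m\<in>A. \<forall>a\<in>A. P m a \<longrightarrow> a = m"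
  proof (rule predicate_Zorn)
    show "partial_order_on A (relation_of P A)"
      by (rule partial_order_on_relation_ofI) (auto simp: P_def)
    fix C assume C: "C \<in> Chains (relation_of P A)"
    show "\<exists>u\<in>A. \<forall>a\<in>C. P a u"
    proof (cases "C = {}")
      case True
      then show ?thesis using q by (auto simp: A_def)
    next
      case False
      have CA: "C \<subseteq> A" using C by (rule Chains_relation_of)
      have ch: "p \<le> p' \<or> p' \<le> p" if "p \<in> C" "p' \<in> C" for p p'
        using C that by (auto simp: Chains_def relation_of_def P_def)
      obtain r where r: "sublinear r" "\<And>p. p \<in> C \<Longrightarrow> r \<le> p"
        using sublinear_Inf_chain[OF False _ _ ch, of q] CA
        by (auto simp: A_def le_fun_def)
      obtain p where "p \<in> C" using False by blast
      then have "r \<le> q" using r(2) CA by (force simp: A_def intro: order_trans)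
      then show ?thesis using r by (auto simp: A_def P_def)
    qed
  qed
  then obtain m where m: "sublinear m" "m \<le> q"
    and min: "\<And>p. sublinear p \<Longrightarrow> p \<le> m \<Longrightarrow> p = m"
    unfolding A_def P_def by (metis (no_types, lifting) mem_Collect_eq order_trans)
  have "m (- y) \<le> - m y" for y
  proof -
    obtain r where r: "sublinear r" "\<And>x. r x \<le> m x" "r (- y) \<le> - m y"
      \<comment> \<open>For this singleton the compatibility condition reads
        \<open>0 \<le> m y - m y\<close>. Were \<open>m\<close> not odd at \<open>y\<close>, the
        function \<open>r\<close> would lie strictly below \<open>m\<close> somewhere, against
        minimality.\<close>
      using sublinear_below_convex[OF m(1), of "{(y, - m y)}"] by auto
    then have "r = m" by (intro min) (auto simp: le_fun_def)
    with r show ?thesis by simp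
  qed
  then have "linear m" by (rule sublinear_odd_imp_linear[OF m(1)])
  then show ?thesis using that m(2) by (auto simp: le_fun_def)
qed

text \<open>With \<open>E\<close> the epigraph of a convex \<open>f\<close>, this puts a linear
  function between \<open>- f\<close> and \<open>q\<close>. Describing \<open>f\<close> by its
  epigraph lets it take the value \<infinity>. The constraint from \<open>E\<close> is first
  absorbed into a smaller sublinear function, so that any linear minorant of that function satisfies
  both bounds.\<close>

theorem sandwich:
  fixes q :: "'a::real_vector \<Rightarrow> real" and E :: "('a \<times> real) set"
  assumes "sublinear q" "convex E" "E \<noteq> {}"
    and "\<And>d b. (d, b) \<in> E \<Longrightarrow> 0 \<le> q d + b"
  obtains m where "linear m" "\<And>x. m x \<le> q x" "\<And>d b. (d, b) \<in> E \<Longrightarrow> - m d \<le> b"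
proof -
  obtain r where r: "sublinear r" "\<And>x. r x \<le> q x" "\<And>d b. (d, b) \<in> E \<Longrightarrow> r (- d) \<le> b"
    using sublinear_below_convex[OF assms] by blast
  obtain m where m: "linear m" "\<And>x. m x \<le> r x"
    using sublinear_dominates_linear[OF r(1)] by blast
  show ?thesis
  proof
    show "m x \<le> q x" for x using m(2) r(2) order_trans by blast
    show "- m d \<le> b" if "(d, b) \<in> E" for d b
      using m(2)[of "- d"] r(3)[OF that] linear_neg[OF m(1), of d] by simp
  qed (rule m)
qed

text \<open>The one-sided estimate at \<open>- x\<close> supplies the missing lower bound for
  \<open>m x\<close>.\<close>

lemma linear_bounded_blinfun:
  fixes m :: "'a::real_normed_vector \<Rightarrow> real"
  assumes m: "linear m" and le: "\<And>x. m x \<le> B * norm x" and B: "0 \<le> B"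
  obtains \<phi> where "blinfun_apply \<phi> = m" "norm \<phi> \<le> B"
proof -
  have nrm: "norm (m x) \<le> B * norm x" for x
    using le[of x] le[of "- x"] linear_neg[OF m, of x] by (simp add: abs_le_iff)
  then have "bounded_linear m"
    using m by (intro bounded_linear_intro[of m B])
      (auto simp: linear_add linear_scale mult.commute)
  then have "blinfun_apply (Blinfun m) = m" by (rule bounded_linear_Blinfun_apply)
  moreover from this have "norm (Blinfun m) \<le> B"
    using nrm B by (intro norm_blinfun_bound) auto
  ultimately show ?thesis using that by blast
qed

subsection \<open>Clarke's directional derivative\<close>

abbreviation clarke_filter :: "'a::real_normed_vector \<Rightarrow> ('a \<times> real) filter"
  where "clarke_filter u \<equiv> nhds u \<times>\<^sub>F at_right 0"

text \<open>This trades the extended real upper limit for eventual strict inequalities between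
  reals, the form in which difference quotients can be added and rescaled.\<close>

lemma clarke_deriv_le_iff:
  "clarke_deriv \<Phi> u v \<le> ereal K \<longleftrightarrow>
    (\<forall>K'>K. \<forall>\<^sub>F (w, t) in clarke_filter u. (\<Phi> (w + t *\<^sub>R v) - \<Phi> w) / t < K')"
  (is "?L \<longleftrightarrow> ?R")
proof
  assume ?L
  show ?R
  proof (intro allI impI)
    fix K' assume "K < K'"
    then show "\<forall>\<^sub>F (w, t) in clarke_filter u. (\<Phi> (w + t *\<^sub>R v) - \<Phi> w) / t < K'"
      using \<open>?L\<close>[unfolded clarke_deriv_def Limsup_le_iff, THEN spec[of _ "ereal K'"]]
      by (simp add: case_prod_unfold)
  qed
next
  assume R: ?R
  show ?L
    unfolding clarke_deriv_def Limsup_le_iff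
  proof (intro allI impI)
    fix y assume "ereal K < y"
    then obtain K' where K': "K < K'" "ereal K' < y"
      using ereal_dense2[of "ereal K" y] by auto
    with R have "\<forall>\<^sub>F (w, t) in clarke_filter u. (\<Phi> (w + t *\<^sub>R v) - \<Phi> w) / t < K'" by blast
    then show "\<forall>\<^sub>F x in clarke_filter u.
        (case x of (w, t) \<Rightarrow> ereal ((\<Phi> (w + t *\<^sub>R v) - \<Phi> w) / t)) < y"
      by eventually_elim (use K'(2) in \<open>auto intro: less_trans[of _ "ereal K'"]\<close>)
  qed
qed

lemma filterlim_clarke_translate:
  "filterlim (\<lambda>(w, t). w + t *\<^sub>R v) (nhds u) (clarke_filter u)"
proof -
  have t: "filterlim snd (nhds (0::real)) (clarke_filter u)"
    by (rule filterlim_mono[OF filterlim_snd[of "at_right 0"]]) (auto simp: at_within_le_nhds)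
  have "((\<lambda>x. fst x + snd x *\<^sub>R v) \<longlongrightarrow> u + 0 *\<^sub>R v) (clarke_filter u)"
    by (intro tendsto_intros filterlim_fst t)
  then show ?thesis by (simp add: case_prod_unfold)
qed

lemma clarke_filter_pos: "\<forall>\<^sub>F (w, t) in clarke_filter u. 0 < t"
  using filterlim_snd[of "at_right (0::real)" "nhds u"] eventually_at_right_less[of "0::real"]
  unfolding filterlim_iff case_prod_unfold by blast

text \<open>Eventually both \<open>w\<close> and \<open>w + t *\<^sub>R v\<close> lie in a ball
  where \<Phi> is Lipschitz, which bounds every difference quotient by
  \<open>L * norm v\<close>.\<close>

lemma clarke_deriv_bounds:
  fixes \<Phi> :: "'a::real_normed_vector \<Rightarrow> real"
  assumes "locally_lipschitz \<Phi>"
  obtains L where "0 \<le> L" "\<And>v. \<bar>clarke_deriv \<Phi> u v\<bar> \<le> ereal (L * norm v)"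
proof -
  obtain r L where r: "r > 0" and L: "L-lipschitz_on (ball u r) \<Phi>"
    using assms unfolding locally_lipschitz_def by blast
  have "\<bar>clarke_deriv \<Phi> u v\<bar> \<le> ereal (L * norm v)" for v
  proof -
    have *: "\<forall>\<^sub>F w in nhds u. w \<in> ball u r"
      using r by (intro eventually_nhds_in_open) auto
    have "\<forall>\<^sub>F x in clarke_filter u. fst x \<in> ball u r"
      using * filterlim_fst[of "nhds u" "at_right (0::real)"] by (auto simp: filterlim_iff)
    moreover have "\<forall>\<^sub>F x in clarke_filter u. (\<lambda>(w, t). w + t *\<^sub>R v) x \<in> ball u r"
      using * filterlim_clarke_translate[of v u] unfolding filterlim_iff by blast
    ultimately have ev: "\<forall>\<^sub>F x in clarke_filter u.
        \<bar>(\<Phi> (fst x + snd x *\<^sub>R v) - \<Phi> (fst x)) / snd x\<bar> \<le> L * norm v"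
      using clarke_filter_pos[of u]
    proof eventually_elim
      case (elim x)
      then have "\<bar>\<Phi> (fst x + snd x *\<^sub>R v) - \<Phi> (fst x)\<bar> \<le> L * (snd x * norm v)"
        using lipschitz_onD[OF L, of "fst x + snd x *\<^sub>R v" "fst x"]
        by (auto simp: case_prod_unfold dist_norm)
      then show ?case using elim by (auto simp: case_prod_unfold field_simps)
    qed
    have "clarke_deriv \<Phi> u v \<le> ereal (L * norm v)"
      unfolding clarke_deriv_def
    proof (rule Limsup_bounded)
      show "\<forall>\<^sub>F x in clarke_filter u.
          (case x of (w, t) \<Rightarrow> ereal ((\<Phi> (w + t *\<^sub>R v) - \<Phi> w) / t)) \<le> ereal (L * norm v)"
        using ev by eventually_elim (simp only: case_prod_unfold ereal_less_eq abs_le_iff)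
    qed
    moreover have "ereal (- (L * norm v)) \<le> clarke_deriv \<Phi> u v"
      unfolding clarke_deriv_def
    \<comment> \<open>A lower bound on the quotients first bounds the lower limit; passing to the
      upper limit requires a nontrivial filter.\<close>
    proof (rule order_trans[OF Liminf_bounded Liminf_le_Limsup])
      show "\<forall>\<^sub>F x in clarke_filter u. ereal (- (L * norm v)) \<le>
          (case x of (w, t) \<Rightarrow> ereal ((\<Phi> (w + t *\<^sub>R v) - \<Phi> w) / t))"
        using ev by eventually_elim
          (simp only: case_prod_unfold ereal_less_eq abs_le_iff minus_le_iff[of "L * norm v"])
      show "clarke_filter u \<noteq> bot"
        by (simp add: prod_filter_eq_bot trivial_limit_at_right_real)
    qed
    ultimately show ?thesis by (cases "clarke_deriv \<Phi> u v") auto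
  qed
  then show ?thesis using that lipschitz_on_nonneg[OF L] by blast
qed

text \<open>The quotient along \<open>a + b\<close> at \<open>w\<close> is the quotient along
  \<open>a\<close> at \<open>w\<close> plus the quotient along \<open>b\<close> at
  \<open>w + t *\<^sub>R a\<close>. The moving base point in Clarke's upper limit absorbs the
  shift.\<close>

lemma clarke_deriv_add_le:
  assumes a: "clarke_deriv \<Phi> u a \<le> ereal A" and b: "clarke_deriv \<Phi> u b \<le> ereal B"
  shows "clarke_deriv \<Phi> u (a + b) \<le> ereal (A + B)"
  unfolding clarke_deriv_le_iff
proof (intro allI impI)
  fix K assume "A + B < K"
  define e where "e = (K - (A + B)) / 2"
  have e: "e > 0" "K = (A + e) + (B + e)" using \<open>A + B < K\<close> by (auto simp: e_def field_simps)
  have evb: "\<forall>\<^sub>F (w, t) in clarke_filter u. (\<Phi> (w + t *\<^sub>R b) - \<Phi> w) / t < B + e"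
    and eva: "\<forall>\<^sub>F (w, t) in clarke_filter u. (\<Phi> (w + t *\<^sub>R a) - \<Phi> w) / t < A + e"
    using a b e(1) by (auto simp: clarke_deriv_le_iff)
  have "filterlim (\<lambda>x. (fst x + snd x *\<^sub>R a, snd x)) (clarke_filter u) (clarke_filter u)"
    using filterlim_clarke_translate[of a u]
    by (intro filterlim_Pair filterlim_snd) (simp add: case_prod_unfold)
  then have "\<forall>\<^sub>F x in clarke_filter u.
      (\<Phi> (fst x + snd x *\<^sub>R a + snd x *\<^sub>R b) - \<Phi> (fst x + snd x *\<^sub>R a)) / snd x < B + e"
    by (rule eventually_compose_filterlim[OF evb, THEN eventually_mono]) simp
  with eva show "\<forall>\<^sub>F (w, t) in clarke_filter u. (\<Phi> (w + t *\<^sub>R (a + b)) - \<Phi> w) / t < K"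
  proof eventually_elim
    case (elim x)
    then show ?case
      by (simp add: case_prod_unfold e(2) scaleR_add_right add.assoc diff_divide_distrib)
  qed
qed

text \<open>The quotient along \<open>s *\<^sub>R v\<close> with step \<open>t\<close> is
  \<open>s\<close> times the quotient along \<open>v\<close> with step \<open>s * t\<close>.\<close>

lemma clarke_deriv_scale_le:
  assumes v: "clarke_deriv \<Phi> u v \<le> ereal A" and s: "s > 0"
  shows "clarke_deriv \<Phi> u (s *\<^sub>R v) \<le> ereal (s * A)"
  unfolding clarke_deriv_le_iff
proof (intro allI impI)
  fix K assume "s * A < K"
  then have "A < K / s" using s by (simp add: field_simps)
  then have ev: "\<forall>\<^sub>F (w, t) in clarke_filter u. (\<Phi> (w + t *\<^sub>R v) - \<Phi> w) / t < K / s"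
    using v by (simp add: clarke_deriv_le_iff)
  have "filterlim (\<lambda>t. s * t) (at_right 0) (at_right (0::real))"
    using s by (intro filterlim_at_withinI eventually_at_right_less[THEN eventually_mono])
      (auto intro!: tendsto_eq_intros)
  then have "filterlim (\<lambda>x. (fst x, s * snd x)) (clarke_filter u) (clarke_filter u)"
    by (intro filterlim_Pair filterlim_fst filterlim_compose[OF _ filterlim_snd])
  then have "\<forall>\<^sub>F x in clarke_filter u.
      (\<Phi> (fst x + (s * snd x) *\<^sub>R v) - \<Phi> (fst x)) / (s * snd x) < K / s"
    by (rule eventually_compose_filterlim[OF ev, THEN eventually_mono]) simp
  then show "\<forall>\<^sub>F (w, t) in clarke_filter u. (\<Phi> (w + t *\<^sub>R (s *\<^sub>R v)) - \<Phi> w) / t < K"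
    using clarke_filter_pos[of u]
  proof eventually_elim
    case (elim x)
    then have "(\<Phi> (fst x + snd x *\<^sub>R s *\<^sub>R v) - \<Phi> (fst x)) / snd x / s < K / s"
      by (simp add: mult.commute)
    then show ?case using s by (simp only: case_prod_unfold divide_less_cancel if_True)
  qed
qed

lemma clarke_deriv_sublinear:
  fixes \<Phi> :: "'a::real_normed_vector \<Rightarrow> real"
  assumes "locally_lipschitz \<Phi>"
  obtains p L where "\<And>v. clarke_deriv \<Phi> u v = ereal (p v)" "sublinear p" "0 \<le> L"
    "\<And>v. p v \<le> L * norm v"
proof -
  obtain L where L: "0 \<le> L" "\<And>v. \<bar>clarke_deriv \<Phi> u v\<bar> \<le> ereal (L * norm v)"
    using clarke_deriv_bounds[OF assms] by blast
  define p where "p v = real_of_ereal (clarke_deriv \<Phi> u v)" for v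
  have p: "clarke_deriv \<Phi> u v = ereal (p v)" for v
    unfolding p_def using L(2)[of v] by (cases "clarke_deriv \<Phi> u v") auto
  have bound: "\<bar>p v\<bar> \<le> L * norm v" for v using L(2)[of v] by (simp add: p)
  have add: "p (x + y) \<le> p x + p y" for x y
    using clarke_deriv_add_le[of \<Phi> u x "p x" y "p y"] by (simp add: p)
  \<comment> \<open>The scaling bound points upwards, so it is applied to
    \<open>s *\<^sub>R x\<close> with factor \<open>inverse s\<close> to obtain a lower
    bound.\<close>
  have scale: "s * p x \<le> p (s *\<^sub>R x)" if "s > 0" for s x
    using clarke_deriv_scale_le[of \<Phi> u "s *\<^sub>R x" "p (s *\<^sub>R x)" "inverse s"] that
    by (simp add: p field_simps)
  have "p 0 = 0" using bound[of 0] by simp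
  with add scale have "sublinear p" by (rule sublinearI)
  moreover have "p v \<le> L * norm v" for v using bound[of v] by (rule abs_le_D1)
  ultimately show ?thesis using that p L(1) by blast
qed

subsection \<open>Approximate critical points\<close>

text \<open>For \<open>\<Psi> u = ereal a\<close> the set is the epigraph of the increment of \<Psi>
  at \<open>u\<close>. Moving \<open>a\<close> to the right-hand side avoids subtraction of extended
  reals.\<close>

lemma convex_epigraph_translate:
  assumes "convex_ereal \<Psi>"
  shows "convex {(h, b). \<Psi> (u + h) \<le> ereal (b + a)}"
  unfolding convex_def
proof (clarsimp, goal_cases)
  case (1 x b y b' s t)
  have eq: "u + (s *\<^sub>R x + t *\<^sub>R y) = s *\<^sub>R (u + x) + t *\<^sub>R (u + y)"
    using scaleR_left_distrib[of s t u] \<open>s + t = 1\<close> by (simp add: algebra_simps)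
  have "\<Psi> (u + (s *\<^sub>R x + t *\<^sub>R y)) \<le> ereal s * \<Psi> (u + x) + ereal t * \<Psi> (u + y)"
    unfolding eq using assms 1 by (simp add: convex_ereal_def)
  also have "\<dots> \<le> ereal s * ereal (b + a) + ereal t * ereal (b' + a)"
    using 1 by (intro add_mono ereal_mult_left_mono) auto
  also have "\<dots> = ereal (s * b + t * b' + (s + t) * a)" by (simp add: algebra_simps)
  finally show ?case using \<open>s + t = 1\<close> by simp
qed

lemma convex_epigraph_norm_minus_linear:
  fixes m :: "'a::real_normed_vector \<Rightarrow> real"
  assumes m: "linear m" and e: "0 \<le> e"
  shows "convex {(h, b). e * norm h - m h \<le> b}"
  unfolding convex_def
proof (clarsimp, goal_cases)
  case (1 x b y b' s t)
  have "norm (s *\<^sub>R x + t *\<^sub>R y) \<le> s * norm x + t * norm y"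
    using norm_triangle_ineq[of "s *\<^sub>R x" "t *\<^sub>R y"] 1 by simp
  then have "e * norm (s *\<^sub>R x + t *\<^sub>R y) \<le> e * (s * norm x + t * norm y)"
    using e by (rule mult_left_mono)
  moreover have "s * (e * norm x - m x) \<le> s * b" "t * (e * norm y - m y) \<le> t * b'"
    using 1 by (simp_all add: mult_left_mono)
  ultimately show ?case
    by (simp add: linear_add[OF m] linear_scale[OF m] algebra_simps)
qed

lemma approx_critical_decompose:
  fixes \<Phi> :: "'a::real_normed_vector \<Rightarrow> real"
  assumes \<Phi>: "locally_lipschitz \<Phi>" and \<Psi>: "convex_ereal \<Psi>"
    and a: "\<Psi> u = ereal a" and e: "0 \<le> e"
    and ineq: "\<And>v. clarke_deriv \<Phi> u (v - u) + \<Psi> v - \<Psi> u \<ge> ereal (- e * norm (v - u))"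
  obtains w where "w \<in> generalized_gradient \<Phi> u + subdifferential \<Psi> u" "norm w \<le> e"
proof -
  obtain p L where p: "\<And>v. clarke_deriv \<Phi> u v = ereal (p v)" "sublinear p"
    and L: "0 \<le> L" "\<And>v. p v \<le> L * norm v"
    using clarke_deriv_sublinear[OF \<Phi>] by blast
  define q where "q h = p h + e * norm h" for h
  have q: "sublinear q"
    unfolding sublinear_def
  proof (intro conjI allI impI)
    show "q (x + y) \<le> q x + q y" for x y
      using sublinear_add[OF p(2), of x y] mult_left_mono[OF norm_triangle_ineq e, of x y]
      by (simp add: q_def algebra_simps)
    show "q (s *\<^sub>R x) = s * q x" if "s \<ge> 0" for s x
      using that by (simp add: q_def sublinear_scale[OF p(2)] algebra_simps)
  qed
  \<comment> \<open>First separation: the linear \<open>m\<close> satisfies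
    \<open>- m h \<le> \<Psi> (u + h) - a\<close> and \<open>m \<le> q\<close>.\<close>
  let ?E = "{(h, b). \<Psi> (u + h) \<le> ereal (b + a)}"
  have "0 \<le> q h + b" if "(h, b) \<in> ?E" for h b
    using ineq[of "u + h"] that by (cases "\<Psi> (u + h)") (auto simp: p(1) a q_def)
  moreover have "(0, 0) \<in> ?E" using a by simp
  ultimately obtain m where m: "linear m" "\<And>x. m x \<le> q x" "\<And>h b. (h, b) \<in> ?E \<Longrightarrow> - m h \<le> b"
    using sandwich[OF q convex_epigraph_translate[OF \<Psi>, of u a]] by blast
  \<comment> \<open>Second separation: \<open>m \<le> q\<close> says that
    \<open>m h - e * norm h \<le> p h\<close>, so a linear \<open>l\<close> fits between these two
    functions of \<open>h\<close>.\<close>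
  let ?F = "{(h, b). e * norm h - m h \<le> b}"
  have "0 \<le> p h + b" if "(h, b) \<in> ?F" for h b
    using m(2)[of h] that by (simp add: q_def)
  moreover have "(0, 0) \<in> ?F" by (simp add: linear_0[OF m(1)])
  ultimately obtain l where l: "linear l" "\<And>x. l x \<le> p x" "\<And>h b. (h, b) \<in> ?F \<Longrightarrow> - l h \<le> b"
    using sandwich[OF p(2) convex_epigraph_norm_minus_linear[OF m(1) e]] by blast
  obtain \<phi> where \<phi>: "blinfun_apply \<phi> = l"
    using linear_bounded_blinfun[OF l(1), of L] l(2) L by (meson order_trans)
  have "m x - l x \<le> e * norm x" for x using l(3)[of x "e * norm x - m x"] by simp
  then obtain \<zeta> where \<zeta>: "blinfun_apply \<zeta> = (\<lambda>x. m x - l x)" "norm \<zeta> \<le> e"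
    using linear_bounded_blinfun[OF linear_compose_sub[OF m(1) l(1)], of e] e by blast
  have "\<phi> \<in> generalized_gradient \<Phi> u"
    using l(2) by (simp add: generalized_gradient_def p(1) \<phi>)
  \<comment> \<open>Since \<open>\<zeta>\<close> represents \<open>m - l\<close> and
    \<open>\<phi>\<close> represents \<open>l\<close>, this functional is \<open>- m\<close>. Its
    sum with \<open>\<phi>\<close> is \<open>- \<zeta>\<close>, of norm at most
    \<open>e\<close>.\<close>
  moreover have "- \<zeta> - \<phi> \<in> subdifferential \<Psi> u"
  proof -
    have "ereal (- m (v - u)) \<le> \<Psi> v - \<Psi> u" for v
    proof (cases "\<Psi> v")
      case (real b)
      then show ?thesis using m(3)[of "v - u" "b - a"] by (simp add: a)
    next
      case MInf
      \<comment> \<open>The value \<open>-\<infinity>\<close> would place \<open>(v - u, b)\<close>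
        in \<open>?E\<close> for every real \<open>b\<close>, which is absurd for \<open>b\<close>
        below \<open>- m (v - u)\<close>.\<close>
      then have "- m (v - u) \<le> b" for b using m(3)[of "v - u" b] by simp
      from this[of "- m (v - u) - 1"] show ?thesis by simp
    qed (simp add: a)
    then show ?thesis
      by (simp add: subdifferential_def effective_domain_def a blinfun.diff_left
          blinfun.minus_left \<phi> \<zeta>(1))
  qed
  ultimately have "\<phi> + (- \<zeta> - \<phi>) \<in> generalized_gradient \<Phi> u + subdifferential \<Psi> u"
    by (rule set_plus_intro)
  then show ?thesis using that \<zeta>(2) by simp
qed

text \<open>The two gradient inequalities add up to a lower bound by \<open>w\<close> applied to
  \<open>v - u\<close>, which the operator norm controls.\<close>

lemma gradient_sum_imp_approx_critical:
  assumes w: "w \<in> generalized_gradient \<Phi> u + subdifferential \<Psi> u"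
    and \<Psi>: "proper_fun \<Psi>" and e: "norm w \<le> e"
  shows "clarke_deriv \<Phi> u (v - u) + \<Psi> v - \<Psi> u \<ge> ereal (- e * norm (v - u))"
proof -
  obtain \<phi> \<psi> where w_eq: "w = \<phi> + \<psi>"
    and \<phi>: "ereal (blinfun_apply \<phi> (v - u)) \<le> clarke_deriv \<Phi> u (v - u)"
    and \<psi>: "ereal (blinfun_apply \<psi> (v - u)) \<le> \<Psi> v - \<Psi> u" and "\<Psi> u < \<infinity>"
    using w by (auto simp: generalized_gradient_def subdifferential_def effective_domain_def
        elim!: set_plus_elim)
  have pr: "\<Psi> v > -\<infinity>" "\<Psi> u > -\<infinity>" using \<Psi> by (auto simp: proper_fun_def)
  have "\<bar>blinfun_apply w (v - u)\<bar> \<le> norm w * norm (v - u)"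
    using norm_blinfun[of w "v - u"] by simp
  also have "\<dots> \<le> e * norm (v - u)" using e by (rule mult_right_mono) simp
  finally have "ereal (- e * norm (v - u)) \<le>
      ereal (blinfun_apply \<phi> (v - u)) + ereal (blinfun_apply \<psi> (v - u))"
    by (simp add: w_eq blinfun.add_left abs_le_iff)
  also have "\<dots> \<le> clarke_deriv \<Phi> u (v - u) + (\<Psi> v - \<Psi> u)" using \<phi> \<psi> by (rule add_mono)
  \<comment> \<open>Regrouping these extended reals is legitimate because \<open>\<Psi> u\<close> is
    finite.\<close>
  also have "\<dots> = clarke_deriv \<Phi> u (v - u) + \<Psi> v - \<Psi> u"
    using pr \<open>\<Psi> u < \<infinity>\<close> by (cases "\<Psi> u"; cases "\<Psi> v"; cases "clarke_deriv \<Phi> u (v - u)") auto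
  finally show ?thesis .
qed

section \<open>Characterization of Palais--Smale sequences\<close>

lemma effective_domain_functional_sum:
  "effective_domain (functional_sum \<Phi> \<Psi>) = effective_domain \<Psi>"
  by (auto simp: effective_domain_def functional_sum_def)

theorem lemma2p4:
  fixes \<Phi> :: "'a::banach \<Rightarrow> real"
    and \<Psi> :: "'a \<Rightarrow> ereal"
    and c :: real
    and u :: "nat \<Rightarrow> 'a"
  assumes "locally_lipschitz \<Phi>"
    and "convex_ereal \<Psi>"
    and "lower_semicontinuous \<Psi>"
    and "proper_fun \<Psi>"
  shows "PS_sequence \<Phi> \<Psi> c u \<longleftrightarrow>
    (\<lambda>n. functional_sum \<Phi> \<Psi> (u n)) \<longlonglongrightarrow> ereal c \<and>
    (\<exists>w :: nat \<Rightarrow> ('a \<Rightarrow>\<^sub>L real). w \<longlonglongrightarrow> 0 \<and>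
       (\<forall>n. w n \<in> generalized_gradient \<Phi> (u n) + subdifferential \<Psi> (u n)))"
  (is "?PS \<longleftrightarrow> ?conv \<and> ?grad")
proof
  assume ?PS
  then obtain \<epsilon> :: "nat \<Rightarrow> real" where conv: ?conv and dom: "\<And>n. u n \<in> effective_domain \<Psi>"
    and \<epsilon>: "\<And>n. \<epsilon> n > 0" "\<epsilon> \<longlonglongrightarrow> 0"
    and ineq: "\<And>n v. clarke_deriv \<Phi> (u n) (v - u n) + \<Psi> v - \<Psi> (u n)
                \<ge> ereal (- \<epsilon> n * norm (v - u n))"
    by (auto simp: PS_sequence_def effective_domain_functional_sum)
  have "\<exists>w. w \<in> generalized_gradient \<Phi> (u n) + subdifferential \<Psi> (u n) \<and> norm w \<le> \<epsilon> n" for n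
  proof -
    have "\<Psi> (u n) < \<infinity>" "\<Psi> (u n) > -\<infinity>"
      using dom[of n] \<open>proper_fun \<Psi>\<close> by (auto simp: effective_domain_def proper_fun_def)
    then obtain a where "\<Psi> (u n) = ereal a" by (cases "\<Psi> (u n)") auto
    then show ?thesis
      using approx_critical_decompose[OF assms(1,2) _ less_imp_le[OF \<epsilon>(1)] ineq] by metis
  qed
  then obtain w where w: "\<And>n. w n \<in> generalized_gradient \<Phi> (u n) + subdifferential \<Psi> (u n)"
    and le: "\<And>n. norm (w n) \<le> \<epsilon> n" by metis
  have "w \<longlonglongrightarrow> 0" by (rule Lim_null_comparison[OF always_eventually \<epsilon>(2)]) (simp add: le)
  with conv w show "?conv \<and> ?grad" by blast
next
  assume "?conv \<and> ?grad"
  then obtain w :: "nat \<Rightarrow> ('a \<Rightarrow>\<^sub>L real)" where conv: ?conv and lim: "w \<longlonglongrightarrow> 0"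
    and w: "\<And>n. w n \<in> generalized_gradient \<Phi> (u n) + subdifferential \<Psi> (u n)" by blast
  \<comment> \<open>The added null sequence makes the error strictly positive even where
    \<open>w n = 0\<close>.\<close>
  define \<epsilon> where "\<epsilon> n = norm (w n) + inverse (real (Suc n))" for n
  have "u n \<in> effective_domain \<Psi>" for n
    using w[of n] by (auto simp: subdifferential_def elim!: set_plus_elim)
  moreover have "\<epsilon> n > 0" for n by (simp add: \<epsilon>_def add_nonneg_pos)
  moreover have "\<epsilon> \<longlonglongrightarrow> 0"
    unfolding \<epsilon>_def using tendsto_add[OF tendsto_norm_zero[OF lim] LIMSEQ_inverse_real_of_nat]
    by simp
  moreover have "clarke_deriv \<Phi> (u n) (v - u n) + \<Psi> v - \<Psi> (u n)
      \<ge> ereal (- \<epsilon> n * norm (v - u n))" for n v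
    using w[of n] assms(4) by (rule gradient_sum_imp_approx_critical) (simp add: \<epsilon>_def)
  ultimately show ?PS
    using conv unfolding PS_sequence_def effective_domain_functional_sum by blast
qed

end
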